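(* Let $G$ be a finite connected regular simple graph with constant edge degree $d'(e)=2q\geq 4$. Then there exist a constant $C_G>0$ and a number $\beta\in[q^{-1/2},1)$, both depending only on $G$, such that for every function $f:E\to\mathbb{R}$ on the edges of $G$, every basepoint $v_0\in\widetilde{V}$ and every integer $r\geq 0$, $$\Big|M_{r,v_0}(f)-\frac{1}{|E|}\sum_{e\in E}f(e)\Big|\leq C_G\,\|f\|_2\,\beta^r .$$ In particular $C_G$ is independent of $v_0$.
   Context: $G$ is a graph with vertex set $V$ and edge set $E$; it is simple if it has no loops and no multiple edges. The edge degree $d'(e)$ is the number of edges (other than $e$) meeting $e$ in either of its endpoints, i.e. the vertex degree of $e$ in the line graph of $G$; thus $G$ here is regular with all vertex degrees $q+1$. The universal cover $\widetilde{G}$ of $G$ is the tree, with vertex set $\widetilde{V}$ and edge set $\widetilde{E}$, whose vertices are the non-backtracking paths in $G$ starting at a fixed root vertex, two such paths being neighbours if they differ by exactly one edge at the end. The projection $\pi:\widetilde{G}\to G$ sends a path to its terminal vertex, and an edge of $\widetilde{G}$ to the edge of $G$ by which the two paths differ. The lift of $f:E\to\mathbb{R}$ is $\tilde f=f\circ\pi:\widetilde{E}\to\mathbb{R}$. With $\delta$ the combinatorial distance between vertices of $\widetilde{G}$, the edge sphere is $$S'_r(v_0)=\{e=\{x,y\}\in\widetilde{E}:\min\{\delta(x,v_0),\delta(y,v_0)\}=r\},$$ and the spherical mean is $$M_{r,v_0}(f)=\frac{1}{|S'_r(v_0)|}\sum_{e\in S'_r(v_0)}\tilde f(e).$$ The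 norm is $\|f\|_2=\big(\sum_{e\in E}f(e)^2\big)^{1/2}$. *)

theory Defs
  imports Complex_Main
begin

text \<open>
  A graph is a vertex set together with a set of edges, each edge being a two-element set of
  vertices; so there are no loops and no multiple edges. Finiteness is kept separate, because the
  universal cover is an infinite graph and shares the notions of walk and distance.
\<close>

definition simple_graph :: "'a set \<Rightarrow> 'a set set \<Rightarrow> bool" where
  "simple_graph V E \<longleftrightarrow> (\<forall>e\<in>E. e \<subseteq> V \<and> card e = 2)"

definition vertex_degree :: "'a set set \<Rightarrow> 'a \<Rightarrow> nat" where
  "vertex_degree E v = card {e \<in> E. v \<in> e}"

definition regular_graph :: "'a set \<Rightarrow> 'a set set \<Rightarrow> bool" where
  "regular_graph V E \<longleftrightarrow> (\<exists>k. \<forall>v\<in>V. vertex_degree E v = k)"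

definition edge_degree :: "'a set set \<Rightarrow> 'a set \<Rightarrow> nat" where
  "edge_degree E e = card {e' \<in> E. e' \<noteq> e \<and> e' \<inter> e \<noteq> {}}"

text \<open>
  A walk is the list of its vertices, so a walk with \<open>n\<close> edges is a list of length \<open>n + 1\<close>.
\<close>

definition walk :: "'a set \<Rightarrow> 'a set set \<Rightarrow> 'a list \<Rightarrow> bool" where
  "walk V E p \<longleftrightarrow>
     p \<noteq> [] \<and> set p \<subseteq> V \<and> (\<forall>i. Suc i < length p \<longrightarrow> {p ! i, p ! Suc i} \<in> E)"

definition connected_graph :: "'a set \<Rightarrow> 'a set set \<Rightarrow> bool" where
  "connected_graph V E \<longleftrightarrow>
     V \<noteq> {} \<and> (\<forall>u\<in>V. \<forall>v\<in>V. \<exists>p. walk V E p \<and> hd p = u \<and> last p = v)"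

definition graph_dist :: "'a set \<Rightarrow> 'a set set \<Rightarrow> 'a \<Rightarrow> 'a \<Rightarrow> nat" where
  "graph_dist V E u v =
     (LEAST n. \<exists>p. walk V E p \<and> hd p = u \<and> last p = v \<and> length p = Suc n)"

text \<open>
  In a simple graph a walk traverses the same edge twice in succession exactly if it returns to a
  vertex after two steps.
\<close>

definition non_backtracking :: "'a list \<Rightarrow> bool" where
  "non_backtracking p \<longleftrightarrow> (\<forall>i. i + 2 < length p \<longrightarrow> p ! i \<noteq> p ! (i + 2))"

definition cover_verts :: "'a set \<Rightarrow> 'a set set \<Rightarrow> 'a \<Rightarrow> 'a list set" where
  "cover_verts V E v_root = {p. walk V E p \<and> non_backtracking p \<and> hd p = v_root}"

definition cover_edges :: "'a set \<Rightarrow> 'a set set \<Rightarrow> 'a \<Rightarrow> 'a list set set" where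
  "cover_edges V E v_root =
     {{p, p @ [x]} | p x. p \<in> cover_verts V E v_root \<and> p @ [x] \<in> cover_verts V E v_root}"

definition cover_dist :: "'a set \<Rightarrow> 'a set set \<Rightarrow> 'a \<Rightarrow> 'a list \<Rightarrow> 'a list \<Rightarrow> nat" where
  "cover_dist V E v_root = graph_dist (cover_verts V E v_root) (cover_edges V E v_root)"

text \<open>
  The projection sends a path to its last vertex, hence the edge \<open>{p, p @ [x]}\<close> of the cover to the
  edge \<open>{last p, x}\<close> of the graph.
\<close>

definition proj_vert :: "'a list \<Rightarrow> 'a" where
  "proj_vert p = last p"

definition proj_edge :: "'a list set \<Rightarrow> 'a set" where
  "proj_edge e = proj_vert ` e"

definition edge_lift :: "('a set \<Rightarrow> real) \<Rightarrow> 'a list set \<Rightarrow> real" where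
  "edge_lift f = f \<circ> proj_edge"

definition edge_sphere :: "'a set \<Rightarrow> 'a set set \<Rightarrow> 'a \<Rightarrow> nat \<Rightarrow> 'a list \<Rightarrow> 'a list set set" where
  "edge_sphere V E v_root r v0 =
     {e \<in> cover_edges V E v_root. \<exists>x y. e = {x, y} \<and>
        min (cover_dist V E v_root x v0) (cover_dist V E v_root y v0) = r}"

definition spherical_mean ::
  "'a set \<Rightarrow> 'a set set \<Rightarrow> 'a \<Rightarrow> nat \<Rightarrow> 'a list \<Rightarrow> ('a set \<Rightarrow> real) \<Rightarrow> real" where
  "spherical_mean V E v_root r v0 f =
     (1 / real (card (edge_sphere V E v_root r v0))) *
       (\<Sum>e\<in>edge_sphere V E v_root r v0. edge_lift f e)"

text \<open>
  Functions on the edges are total functions on vertex sets of which only the values on \<open>E\<close> matter.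
\<close>

definition edge_norm :: "'a set set \<Rightarrow> ('a set \<Rightarrow> real) \<Rightarrow> real" where
  "edge_norm E f = sqrt (\<Sum>e\<in>E. (f e)\<^sup>2)"

end

(*
  Write q P g (x, y) for the sum of g (y, z) over the neighbours z of y other than x. The covers of G
  based at two adjacent vertices are isomorphic over G, so the basepoint may be moved along v0 until
  it is the trivial path at some x; the sphere of radius r then consists of the non-backtracking
  paths of length r + 1 from x, and the spherical mean is the mean of P^r g (x, y) over the
  neighbours y of x, where g (x, y) = f {x, y}. In the l2 norm on arcs P is non-expansive, and a
  sum-of-squares identity shows that |P g| = |g| only if g (y, z) depends on y alone. Hence
  |P (P g)| = |g| only if g (y, z) = a y with a constant on the neighbours of each vertex.
  Orthogonality to all such functions is preserved by P and, as G is connected, it holds for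
  symmetric g of mean zero. On that subspace compactness of the unit sphere gives |P (P g)|^2 <= kappa |g|^2 with
  kappa < 1, which is the exponential decay.
*)
theory Submission
  imports Defs "HOL-Analysis.Function_Topology"
begin

section \<open>Walks, non-backtracking paths and the vertices and edges of the cover\<close>

lemma walk_Cons:
  "walk V E (x # p) \<longleftrightarrow> x \<in> V \<and> (p = [] \<or> {x, hd p} \<in> E \<and> walk V E p)"
proof (cases p)
  case Nil
  then show ?thesis by (simp add: walk_def)
next
  case (Cons y t)
  have "(\<forall>i. Suc i < length (x # p) \<longrightarrow> {(x # p) ! i, (x # p) ! Suc i} \<in> E) \<longleftrightarrow>
      {x, y} \<in> E \<and> (\<forall>i. Suc i < length p \<longrightarrow> {p ! i, p ! Suc i} \<in> E)"
    (is "?L \<longleftrightarrow> ?R")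
  proof
    assume L: ?L
    show ?R
    proof (intro conjI allI impI)
      show "{x, y} \<in> E" using L[rule_format, of 0] Cons by simp
      show "{p ! i, p ! Suc i} \<in> E" if "Suc i < length p" for i
        using L[rule_format, of "Suc i"] that by simp
    qed
  next
    assume R: ?R
    show ?L
    proof (intro allI impI)
      fix i assume "Suc i < length (x # p)"
      then show "{(x # p) ! i, (x # p) ! Suc i} \<in> E"
        using R Cons by (cases i) simp_all
    qed
  qed
  then show ?thesis using Cons by (simp add: walk_def) blast
qed

lemma walk_snoc:
  "p \<noteq> [] \<Longrightarrow> walk V E (p @ [a]) \<longleftrightarrow> walk V E p \<and> a \<in> V \<and> {last p, a} \<in> E"
proof (induction p)
  case Nil
  then show ?case by simp
next
  case (Cons x p)
  then show ?case by (cases p) (auto simp: walk_Cons)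
qed

lemma non_backtracking_Cons:
  "non_backtracking (x # p) \<longleftrightarrow>
    non_backtracking p \<and> (\<forall>y z t. p = y # z # t \<longrightarrow> x \<noteq> z)"
proof
  assume L: "non_backtracking (x # p)"
  show "non_backtracking p \<and> (\<forall>y z t. p = y # z # t \<longrightarrow> x \<noteq> z)"
    unfolding non_backtracking_def
  proof (intro conjI allI impI)
    show "p ! i \<noteq> p ! (i + 2)" if "i + 2 < length p" for i
      using L[unfolded non_backtracking_def, rule_format, of "Suc i"] that by simp
    show "x \<noteq> z" if "p = y # z # t" for y z t
      using L[unfolded non_backtracking_def, rule_format, of 0] that by simp
  qed
next
  assume R: "non_backtracking p \<and> (\<forall>y z t. p = y # z # t \<longrightarrow> x \<noteq> z)"
  show "non_backtracking (x # p)"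
    unfolding non_backtracking_def
  proof (intro allI impI)
    fix i assume i: "i + 2 < length (x # p)"
    show "(x # p) ! i \<noteq> (x # p) ! (i + 2)"
    proof (cases i)
      case 0
      then obtain y z t where "p = y # z # t"
        using i by (cases p; cases "tl p") auto
      then show ?thesis using 0 R by simp
    next
      case (Suc j)
      then show ?thesis using R i by (simp add: non_backtracking_def)
    qed
  qed
qed

lemma non_backtracking_Nil [simp]: "non_backtracking []"
  by (simp add: non_backtracking_def)

lemma non_backtracking_butlast: "non_backtracking (p @ [a]) \<Longrightarrow> non_backtracking p"
  by (induction p) (auto simp: non_backtracking_Cons)

lemma cover_verts_Nil [simp]: "[] \<notin> cover_verts V E x"
  by (simp add: cover_verts_def walk_def)

lemma cover_verts_single [simp]: "[a] \<in> cover_verts V E x \<longleftrightarrow> a = x \<and> x \<in> V"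
  by (auto simp: cover_verts_def walk_Cons non_backtracking_Cons)

lemma cover_verts_Cons2:
  "a # b # p \<in> cover_verts V E x \<longleftrightarrow>
    a = x \<and> x \<in> V \<and> {x, b} \<in> E \<and> b # p \<in> cover_verts V E b \<and> (p = [] \<or> hd p \<noteq> x)"
  by (cases p) (auto simp: cover_verts_def walk_Cons non_backtracking_Cons)

lemma cover_verts_ConsD:
  assumes "p \<in> cover_verts V E x"
  obtains t where "p = x # t"
  using assms by (cases p) (auto simp: cover_verts_def walk_def)

lemma cover_verts_butlast:
  "p @ [a] \<in> cover_verts V E x \<Longrightarrow> p \<noteq> [] \<Longrightarrow> p \<in> cover_verts V E x"
  by (auto simp: cover_verts_def walk_snoc intro: non_backtracking_butlast)

lemma cover_edgesI:
  "p \<in> cover_verts V E x \<Longrightarrow> p @ [a] \<in> cover_verts V E x \<Longrightarrow> {p, p @ [a]} \<in> cover_edges V E x"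
  unfolding cover_edges_def by blast

lemma cover_edgesE:
  assumes "e \<in> cover_edges V E x"
  obtains p a where "e = {p, p @ [a]}" "p \<in> cover_verts V E x" "p @ [a] \<in> cover_verts V E x"
  using assms unfolding cover_edges_def by blast

section \<open>Moving the basepoint of the cover\<close>

lemma walk_map:
  assumes "\<phi> ` V \<subseteq> V'" "\<And>e. e \<in> E \<Longrightarrow> \<phi> ` e \<in> E'" "walk V E p"
  shows "walk V' E' (map \<phi> p)"
  unfolding walk_def
proof (intro conjI allI impI)
  show "map \<phi> p \<noteq> []" "set (map \<phi> p) \<subseteq> V'"
    using assms by (auto simp: walk_def)
  fix i assume i: "Suc i < length (map \<phi> p)"
  then have "{p ! i, p ! Suc i} \<in> E" using assms(3) by (simp add: walk_def)
  from assms(2)[OF this] show "{map \<phi> p ! i, map \<phi> p ! Suc i} \<in> E'" using i by simp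
qed

text \<open>Walks are carried over by \<open>\<phi>\<close> and back by \<open>\<psi>\<close>
  without change of length, and the inverse law returns the endpoints to \<open>u\<close> and
  \<open>v\<close>. So both distances are least elements of the same set of lengths.\<close>

lemma graph_dist_iso:
  assumes "\<phi> ` V \<subseteq> V'" "\<And>e. e \<in> E \<Longrightarrow> \<phi> ` e \<in> E'"
    and "\<psi> ` V' \<subseteq> V" "\<And>e. e \<in> E' \<Longrightarrow> \<psi> ` e \<in> E"
    and inv: "\<And>u. u \<in> V \<Longrightarrow> \<psi> (\<phi> u) = u"
    and "u \<in> V" "v \<in> V"
  shows "graph_dist V' E' (\<phi> u) (\<phi> v) = graph_dist V E u v"
proof -
  have "(\<exists>p. walk V' E' p \<and> hd p = \<phi> u \<and> last p = \<phi> v \<and> length p = Suc n) \<longleftrightarrow>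
      (\<exists>p. walk V E p \<and> hd p = u \<and> last p = v \<and> length p = Suc n)" (is "?L \<longleftrightarrow> ?R") for n
  proof
    assume ?L
    then obtain p where p: "walk V' E' p" "hd p = \<phi> u" "last p = \<phi> v" "length p = Suc n" by blast
    from p(4) have "p \<noteq> []" by auto
    with p walk_map[OF assms(3,4) p(1)] inv assms(6,7) show ?R
      by (intro exI[of _ "map \<psi> p"]) (simp add: hd_map last_map)
  next
    assume ?R
    then obtain p where p: "walk V E p" "hd p = u" "last p = v" "length p = Suc n" by blast
    from p(4) have "p \<noteq> []" by auto
    with p walk_map[OF assms(1,2) p(1)] show ?L
      by (intro exI[of _ "map \<phi> p"]) (simp add: hd_map last_map)
  qed
  then show ?thesis by (simp add: graph_dist_def)
qed

text \<open>The isomorphism over the graph between the covers based at neighbours \<open>x\<close>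
  and \<open>y\<close>: the step from \<open>y\<close> to \<open>x\<close> is put in front, and
  cancelled if the path begins by going from \<open>x\<close> to \<open>y\<close>. The second
  equation serves the trivial path \<open>[x]\<close>.\<close>

fun reroot :: "'a \<Rightarrow> 'a list \<Rightarrow> 'a list" where
  "reroot y (x # z # t) = (if z = y then z # t else y # x # z # t)"
| "reroot y p = y # p"

lemma reroot_Cons: "t \<noteq> [] \<Longrightarrow> reroot y (x # t) = (if hd t = y then t else y # x # t)"
  by (cases t) auto

text \<open>The only backtracking that the new first step can cause is the one cancelled in the
  definition. With the roles of \<open>x\<close> and \<open>y\<close> exchanged the two branches
  undo each other.\<close>

lemma reroot_cover_verts:
  assumes "{x, y} \<in> E" "x \<in> V" "y \<in> V" "p \<in> cover_verts V E x"
  shows "reroot y p \<in> cover_verts V E y" "reroot x (reroot y p) = p" "last (reroot y p) = last p"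
proof -
  have "{y, x} \<in> E" using assms(1) by (simp add: insert_commute)
  then have *: "reroot y p \<in> cover_verts V E y \<and> reroot x (reroot y p) = p \<and>
      last (reroot y p) = last p"
    using assms
    by (induction y p rule: reroot.induct) (auto simp: cover_verts_Cons2 reroot_Cons)
  then show "reroot y p \<in> cover_verts V E y" "reroot x (reroot y p) = p"
    "last (reroot y p) = last p" by auto
qed

text \<open>The second alternative occurs when \<open>[x]\<close> is extended by \<open>y\<close>:
  the images are \<open>[y, x]\<close> and \<open>[y]\<close>, so the edge survives but its longer
  and shorter ends change places.\<close>

lemma reroot_snoc:
  assumes "p \<in> cover_verts V E x" "x \<noteq> y"
  shows "reroot y (p @ [a]) = reroot y p @ [a] \<or>
    reroot y p = reroot y (p @ [a]) @ [x]"
  using assms by (induction y p rule: reroot.induct) (auto simp: cover_verts_def)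

lemma reroot_cover_edges:
  assumes "{x, y} \<in> E" "x \<in> V" "y \<in> V" "x \<noteq> y" "e \<in> cover_edges V E x"
  shows "reroot y ` e \<in> cover_edges V E y"
proof -
  obtain p a where p: "e = {p, p @ [a]}" "p \<in> cover_verts V E x" "p @ [a] \<in> cover_verts V E x"
    using assms(5) by (rule cover_edgesE)
  note v = reroot_cover_verts(1)[OF assms(1-3) p(2)] reroot_cover_verts(1)[OF assms(1-3) p(3)]
  have e: "reroot y ` e = {reroot y p, reroot y (p @ [a])}" using p by simp
  from reroot_snoc[OF p(2) assms(4), of a] show ?thesis
  proof
    assume "reroot y (p @ [a]) = reroot y p @ [a]"
    with v e cover_edgesI show ?thesis by metis
  next
    assume "reroot y p = reroot y (p @ [a]) @ [x]"
    with v e cover_edgesI show ?thesis by (metis insert_commute)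
  qed
qed

text \<open>The two ends of an edge may be named in either order because \<open>min\<close> is
  symmetric, so the shorter path can be taken first.\<close>

lemma edge_sphere_iff:
  "e \<in> edge_sphere V E x r v0 \<longleftrightarrow> (\<exists>p a. e = {p, p @ [a]} \<and> p \<in> cover_verts V E x \<and>
     p @ [a] \<in> cover_verts V E x \<and>
     min (cover_dist V E x p v0) (cover_dist V E x (p @ [a]) v0) = r)" (is "?L \<longleftrightarrow> ?R")
proof
  assume ?L
  then obtain u v where e: "e \<in> cover_edges V E x" "e = {u, v}"
    and m: "min (cover_dist V E x u v0) (cover_dist V E x v v0) = r"
    unfolding edge_sphere_def by blast
  obtain p a where p: "e = {p, p @ [a]}" "p \<in> cover_verts V E x" "p @ [a] \<in> cover_verts V E x"
    using e(1) by (rule cover_edgesE)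
  from e p have "u = p \<and> v = p @ [a] \<or> u = p @ [a] \<and> v = p" by (metis doubleton_eq_iff)
  then have "min (cover_dist V E x p v0) (cover_dist V E x (p @ [a]) v0) = r"
    using m by (elim disjE conjE) (simp_all add: min.commute)
  then show ?R by (intro exI conjI) (rule p)+
next
  assume ?R
  then obtain p a where p: "e = {p, p @ [a]}" "p \<in> cover_verts V E x" "p @ [a] \<in> cover_verts V E x"
    and m: "min (cover_dist V E x p v0) (cover_dist V E x (p @ [a]) v0) = r" by (elim exE conjE)
  from p(1) m cover_edgesI[OF p(2,3)] show ?L
    unfolding edge_sphere_def by (simp only: mem_Collect_eq) (intro conjI exI; simp)
qed

context
  fixes V :: "'a set" and E :: "'a set set" and x y :: 'a
  assumes xy: "{x, y} \<in> E" "x \<in> V" "y \<in> V" "x \<noteq> y"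
begin

lemma cover_dist_reroot:
  assumes "u \<in> cover_verts V E x" "v \<in> cover_verts V E x"
  shows "cover_dist V E y (reroot y u) (reroot y v) = cover_dist V E x u v"
  unfolding cover_dist_def
proof (rule graph_dist_iso)
  have yx: "{y, x} \<in> E" by (subst insert_commute) (rule xy(1))
  have neq: "y \<noteq> x" using xy(4) by (rule not_sym)
  show "reroot y ` cover_verts V E x \<subseteq> cover_verts V E y"
    by (rule image_subsetI) (rule reroot_cover_verts(1)[OF xy(1-3)])
  show "reroot x ` cover_verts V E y \<subseteq> cover_verts V E x"
    by (rule image_subsetI) (rule reroot_cover_verts(1)[OF yx xy(3,2)])
  show "e \<in> cover_edges V E x \<Longrightarrow> reroot y ` e \<in> cover_edges V E y" for e
    by (rule reroot_cover_edges[OF xy])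
  show "e \<in> cover_edges V E y \<Longrightarrow> reroot x ` e \<in> cover_edges V E x" for e
    by (rule reroot_cover_edges[OF yx xy(3,2) neq])
  show "u \<in> cover_verts V E x \<Longrightarrow> reroot x (reroot y u) = u" for u
    by (rule reroot_cover_verts(2)[OF xy(1-3)])
qed (use assms in auto)

lemma edge_sphere_reroot:
  assumes v0: "v0 \<in> cover_verts V E x" and e: "e \<in> edge_sphere V E x r v0"
  shows "reroot y ` e \<in> edge_sphere V E y r (reroot y v0)"
    and "reroot x ` reroot y ` e = e"
    and "proj_edge (reroot y ` e) = proj_edge e"
proof -
  obtain p a where p: "e = {p, p @ [a]}" "p \<in> cover_verts V E x" "p @ [a] \<in> cover_verts V E x"
    and m: "min (cover_dist V E x p v0) (cover_dist V E x (p @ [a]) v0) = r"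
    using e unfolding edge_sphere_iff by (elim exE conjE)
  have "e \<in> cover_edges V E x" using cover_edgesI[OF p(2,3)] p(1) by simp
  then have ed: "reroot y ` e \<in> cover_edges V E y" by (rule reroot_cover_edges[OF xy])
  have "min (cover_dist V E y (reroot y p) (reroot y v0))
      (cover_dist V E y (reroot y (p @ [a])) (reroot y v0)) = r"
    using m cover_dist_reroot p v0 by simp
  moreover have "reroot y ` e = {reroot y p, reroot y (p @ [a])}" using p by simp
  ultimately show "reroot y ` e \<in> edge_sphere V E y r (reroot y v0)"
    using ed unfolding edge_sphere_def mem_Collect_eq by (intro conjI exI)
  note r = reroot_cover_verts(2,3)[OF xy(1-3) p(2)] reroot_cover_verts(2,3)[OF xy(1-3) p(3)]
  show "reroot x ` reroot y ` e = e" using r p by simp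
  show "proj_edge (reroot y ` e) = proj_edge e"
    using r p by (simp add: proj_edge_def proj_vert_def)
qed

end

text \<open>Taking images under \<open>reroot y\<close> is a bijection between the spheres, inverted
  by \<open>reroot x\<close>, and it keeps the projected edge because rerooting keeps last vertices.
  So the sums and the cardinalities agree.\<close>

lemma spherical_mean_reroot:
  assumes xy: "{x, y} \<in> E" "x \<in> V" "y \<in> V" "x \<noteq> y" and v0: "v0 \<in> cover_verts V E x"
  shows "spherical_mean V E y r (reroot y v0) f = spherical_mean V E x r v0 f"
proof -
  have "{y, x} \<in> E" by (subst insert_commute) (rule xy(1))
  then have yx: "{y, x} \<in> E" "y \<in> V" "x \<in> V" "y \<noteq> x" using xy by auto
  note w = reroot_cover_verts(1,2)[OF xy(1-3) v0]
  have b: "bij_betw ((`) (reroot y)) (edge_sphere V E x r v0) (edge_sphere V E y r (reroot y v0))"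
  proof (rule bij_betw_byWitness[where f' = "(`) (reroot x)"])
    show "\<forall>e\<in>edge_sphere V E x r v0. reroot x ` reroot y ` e = e"
      using edge_sphere_reroot(2)[OF xy v0] by blast
    show "\<forall>e\<in>edge_sphere V E y r (reroot y v0). reroot y ` reroot x ` e = e"
      using edge_sphere_reroot(2)[OF yx w(1)] by blast
    show "(`) (reroot y) ` edge_sphere V E x r v0 \<subseteq> edge_sphere V E y r (reroot y v0)"
      using edge_sphere_reroot(1)[OF xy v0] by blast
    show "(`) (reroot x) ` edge_sphere V E y r (reroot y v0) \<subseteq> edge_sphere V E x r v0"
      using edge_sphere_reroot(1)[OF yx w(1)] w(2) by force
  qed
  have "(\<Sum>e\<in>edge_sphere V E y r (reroot y v0). edge_lift f e) =
      (\<Sum>e\<in>edge_sphere V E x r v0. edge_lift f (reroot y ` e))"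
    by (rule sum.reindex_bij_betw[OF b, symmetric])
  also have "\<dots> = (\<Sum>e\<in>edge_sphere V E x r v0. edge_lift f e)"
    by (intro sum.cong refl) (simp add: edge_lift_def edge_sphere_reroot(3)[OF xy v0])
  finally show ?thesis
    by (simp add: spherical_mean_def bij_betw_same_card[OF b])
qed

text \<open>Rerooting \<open>v0\<close> at its own second vertex just drops its first vertex.
  Repeating this shortens the basepoint to the trivial path at its last vertex.\<close>

lemma spherical_mean_trivial_path:
  assumes sg: "simple_graph V E" and "v0 \<in> cover_verts V E x"
  shows "spherical_mean V E x r v0 f = spherical_mean V E (last v0) r [last v0] f \<and> last v0 \<in> V"
  using assms(2)
proof (induction v0 arbitrary: x)
  case Nil
  then show ?case by simp
next
  case (Cons a t)
  show ?case
  proof (cases t)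
    case Nil
    then show ?thesis using Cons.prems by simp
  next
    case (Cons y s)
    have *: "a = x" "x \<in> V" "{x, y} \<in> E" "y # s \<in> cover_verts V E y"
      using Cons.prems Cons by (auto simp: cover_verts_Cons2)
    have "card {x, y} = 2" "{x, y} \<subseteq> V" using sg *(3) unfolding simple_graph_def by blast+
    then have "x \<noteq> y" "y \<in> V" by auto
    then have "spherical_mean V E y r (reroot y (a # t)) f = spherical_mean V E x r (a # t) f"
      using spherical_mean_reroot[OF *(3,2) _ _ Cons.prems] by blast
    moreover have "reroot y (a # t) = t" using Cons by simp
    ultimately show ?thesis using Cons.IH[of y] * Cons by simp
  qed
qed

section \<open>Spheres around the root of the cover\<close>

text \<open>One step in the cover changes the length of a path by exactly one. This is the lower
  bound for the distance to the root.\<close>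

lemma walk_length_bound:
  assumes "walk (cover_verts V E x) (cover_edges V E x) ps"
  shows "length (hd ps) \<le> length (last ps) + (length ps - 1)"
  using assms
proof (induction ps)
  case Nil
  then show ?case by (simp add: walk_def)
next
  case (Cons p ps)
  show ?case
  proof (cases "ps = []")
    case True
    then show ?thesis by simp
  next
    case False
    then have e: "{p, hd ps} \<in> cover_edges V E x" and w: "walk (cover_verts V E x) (cover_edges V E x) ps"
      using Cons.prems by (auto simp: walk_Cons)
    from e obtain u a where "{p, hd ps} = {u, u @ [a]}"
      by (rule cover_edgesE)
    then have "p = u \<and> hd ps = u @ [a] \<or> p = u @ [a] \<and> hd ps = u"
      by (metis doubleton_eq_iff)
    then have "length p \<le> Suc (length (hd ps))"
      by (elim disjE conjE) simp_all
    moreover have "1 \<le> length ps" using False by (simp add: Suc_le_eq)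
    ultimately have "length p \<le> length (last ps) + length ps" using Cons.IH[OF w] by linarith
    then show ?thesis using False by simp
  qed
qed

text \<open>The walk deletes the last vertex again and again; it is the upper bound for the
  distance.\<close>

lemma walk_to_root:
  assumes "p \<in> cover_verts V E x"
  shows "\<exists>ps. walk (cover_verts V E x) (cover_edges V E x) ps \<and> hd ps = p \<and> last ps = [x] \<and>
    length ps = length p"
  using assms
proof (induction p rule: rev_induct)
  case Nil
  then show ?case by simp
next
  case (snoc a p)
  show ?case
  proof (cases "p = []")
    case True
    with snoc.prems have a: "a = x" "x \<in> V" by simp_all
    then show ?thesis using True by (intro exI[of _ "[[x]]"]) (simp add: walk_Cons)
  next
    case False
    then have p: "p \<in> cover_verts V E x" by (rule cover_verts_butlast[OF snoc.prems])
    from snoc.IH[OF p] obtain ps where ps: "walk (cover_verts V E x) (cover_edges V E x) ps"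
      "hd ps = p" "last ps = [x]" "length ps = length p" by (elim exE conjE)
    have "{p @ [a], p} \<in> cover_edges V E x"
      by (subst insert_commute) (rule cover_edgesI[OF p snoc.prems])
    then have "walk (cover_verts V E x) (cover_edges V E x) ((p @ [a]) # ps)"
      unfolding walk_Cons ps(2) using ps(1) snoc.prems by (intro conjI disjI2)
    moreover have "ps \<noteq> []" using ps(1) by (simp add: walk_def)
    ultimately show ?thesis
      by (intro exI[of _ "(p @ [a]) # ps"]) (simp add: ps(3,4))
  qed
qed

lemma cover_dist_root:
  assumes "p \<in> cover_verts V E x"
  shows "cover_dist V E x p [x] = length p - 1"
  unfolding cover_dist_def graph_dist_def
proof (rule Least_equality)
  have "length p = Suc (length p - 1)" using assms by (cases p) simp_all
  with walk_to_root[OF assms] show "\<exists>ps. walk (cover_verts V E x) (cover_edges V E x) ps \<and> hd ps = p \<and>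
      last ps = [x] \<and> length ps = Suc (length p - 1)" by (simp only:)
next
  fix n
  assume "\<exists>ps. walk (cover_verts V E x) (cover_edges V E x) ps \<and> hd ps = p \<and>
      last ps = [x] \<and> length ps = Suc n"
  then obtain ps where "walk (cover_verts V E x) (cover_edges V E x) ps" "hd ps = p"
      "last ps = [x]" "length ps = Suc n" by blast
  with walk_length_bound[of V E x ps] show "length p - 1 \<le> n" by simp
qed

text \<open>Each edge of the tree is determined by its end farther from the root. The nearer end at
  distance \<open>r\<close> has \<open>r + 1\<close> vertices, hence the farther one
  \<open>r + 2\<close>.\<close>

lemma edge_sphere_root:
  "bij_betw (\<lambda>p. {butlast p, p}) {p \<in> cover_verts V E x. length p = r + 2} (edge_sphere V E x r [x])"
  unfolding bij_betw_def
proof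
  show "inj_on (\<lambda>p. {butlast p, p}) {p \<in> cover_verts V E x. length p = r + 2}"
  proof (rule inj_onI)
    fix p p' assume *: "p \<in> {p \<in> cover_verts V E x. length p = r + 2}"
      "p' \<in> {p \<in> cover_verts V E x. length p = r + 2}" "{butlast p, p} = {butlast p', p'}"
    have "p \<noteq> butlast p'"
    proof
      assume "p = butlast p'"
      then have "length p = length p' - 1" by simp
      with * show False by simp
    qed
    with *(3) show "p = p'" by (metis doubleton_eq_iff)
  qed
  show "(\<lambda>p. {butlast p, p}) ` {p \<in> cover_verts V E x. length p = r + 2} = edge_sphere V E x r [x]"
  proof (intro equalityI subsetI)
    fix e assume "e \<in> (\<lambda>p. {butlast p, p}) ` {p \<in> cover_verts V E x. length p = r + 2}"
    then obtain p where p: "e = {butlast p, p}" "p \<in> cover_verts V E x" "length p = r + 2" by blast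
    from p(3) obtain u a where u: "p = u @ [a]" by (cases p rule: rev_cases) auto
    with p have "u \<noteq> []" by auto
    then have "u \<in> cover_verts V E x" using p u cover_verts_butlast by metis
    with p u show "e \<in> edge_sphere V E x r [x]"
      unfolding edge_sphere_iff
      by (intro exI[of _ u] exI[of _ a]) (simp add: cover_dist_root)
  next
    fix e assume "e \<in> edge_sphere V E x r [x]"
    then obtain p a where p: "e = {p, p @ [a]}" "p \<in> cover_verts V E x" "p @ [a] \<in> cover_verts V E x"
      and m: "min (cover_dist V E x p [x]) (cover_dist V E x (p @ [a]) [x]) = r"
      unfolding edge_sphere_iff by (elim exE conjE)
    have "length p = r + 1" using m p by (cases p) (auto simp: cover_dist_root)
    then show "e \<in> (\<lambda>p. {butlast p, p}) ` {p \<in> cover_verts V E x. length p = r + 2}"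
      using p by (intro image_eqI[of _ _ "p @ [a]"]) auto
  qed
qed

text \<open>The projection of the cover edge \<open>{butlast p, p}\<close>.\<close>

definition last_edge :: "'a list \<Rightarrow> 'a set" where
  "last_edge p = {last (butlast p), last p}"

lemma spherical_mean_root:
  "spherical_mean V E x r [x] f =
    (\<Sum>p | p \<in> cover_verts V E x \<and> length p = r + 2. f (last_edge p)) /
    card {p \<in> cover_verts V E x. length p = r + 2}"
proof -
  note b = edge_sphere_root[of V E x r]
  have "(\<Sum>e\<in>edge_sphere V E x r [x]. edge_lift f e) =
      (\<Sum>p | p \<in> cover_verts V E x \<and> length p = r + 2. edge_lift f {butlast p, p})"
    by (rule sum.reindex_bij_betw[OF b, symmetric])
  also have "\<dots> = (\<Sum>p | p \<in> cover_verts V E x \<and> length p = r + 2. f (last_edge p))"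
    by (simp add: edge_lift_def proj_edge_def proj_vert_def last_edge_def)
  finally show ?thesis
    unfolding spherical_mean_def bij_betw_same_card[OF b] by simp
qed

section \<open>Leave-one-out averages on a finite set\<close>

lemma sum_Diff_singleton_swap:
  fixes F :: "'a \<Rightarrow> 'a \<Rightarrow> real"
  assumes "finite N"
  shows "(\<Sum>x\<in>N. \<Sum>z\<in>N - {x}. F x z) = (\<Sum>z\<in>N. \<Sum>x\<in>N - {z}. F x z)"
proof -
  have "(\<Sum>x\<in>N. \<Sum>z | z \<in> N \<and> z \<noteq> x. F x z) = (\<Sum>z\<in>N. \<Sum>x | x \<in> N \<and> z \<noteq> x. F x z)"
    by (rule sum.swap_restrict[OF assms assms])
  moreover have "{z \<in> N. z \<noteq> x} = N - {x}" "{z \<in> N. x \<noteq> z} = N - {x}" for x by auto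
  ultimately show ?thesis by simp
qed

text \<open>On \<open>q + 1\<close> points the leave-one-out average fixes constants and acts as
  \<open>-1/q\<close> on vectors of sum zero. These parts are orthogonal, so the loss in squared
  norm is \<open>1 - 1/q^2\<close> times the squared norm of the mean-free part. The proof expands
  both sides in the sum and the sum of squares.\<close>

lemma sum_leave_one_out_squares:
  fixes c :: "'a \<Rightarrow> real"
  assumes N: "finite N" "card N = q + 1" and q: "q \<ge> 1"
  shows "(\<Sum>z\<in>N. (c z)\<^sup>2) - (\<Sum>x\<in>N. ((\<Sum>z\<in>N - {x}. c z) / q)\<^sup>2) =
    (1 - 1 / (real q)\<^sup>2) * (\<Sum>z\<in>N. (c z - sum c N / (q + 1))\<^sup>2)"
proof -
  define s where "s = sum c N"
  define C where "C = (\<Sum>z\<in>N. (c z)\<^sup>2)"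
  have "(\<Sum>x\<in>N. ((\<Sum>z\<in>N - {x}. c z) / q)\<^sup>2) = (\<Sum>x\<in>N. (s\<^sup>2 - 2 * s * c x + (c x)\<^sup>2) / (real q)\<^sup>2)"
    using N by (intro sum.cong refl) (simp add: sum_diff1 s_def power_divide power2_diff algebra_simps)
  also have "\<dots> = ((q + 1) * s\<^sup>2 - 2 * s * s + C) / (real q)\<^sup>2"
    using N by (simp add: sum.distrib sum_subtractf flip: sum_divide_distrib sum_distrib_left s_def C_def)
  finally have 1: "(\<Sum>x\<in>N. ((\<Sum>z\<in>N - {x}. c z) / q)\<^sup>2) = ((q + 1) * s\<^sup>2 - 2 * s * s + C) / (real q)\<^sup>2" .
  have "(\<Sum>z\<in>N. (c z - s / (q + 1))\<^sup>2) = (\<Sum>z\<in>N. (c z)\<^sup>2 - 2 * (s / (q + 1)) * c z + (s / (q + 1))\<^sup>2)"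
    by (intro sum.cong refl) (simp add: power2_diff algebra_simps)
  also have "\<dots> = C - 2 * (s / (q + 1)) * s + (q + 1) * (s / (q + 1))\<^sup>2"
    unfolding sum.distrib sum_subtractf sum_distrib_left[symmetric] s_def C_def using N by simp
  also have "\<dots> = C - s\<^sup>2 / (q + 1)"
  proof -
    have "n * (s / n)\<^sup>2 = s\<^sup>2 / n" if "n \<noteq> 0" for n by (simp add: that power2_eq_square)
    from this[of "q + 1"] show ?thesis by (simp add: power2_eq_square)
  qed
  finally have 2: "(\<Sum>z\<in>N. (c z - s / (q + 1))\<^sup>2) = C - s\<^sup>2 / (q + 1)" .
  have "C - ((q + 1) * s\<^sup>2 - 2 * s * s + C) / (real q)\<^sup>2 = (1 - 1 / (real q)\<^sup>2) * (C - s\<^sup>2 / (q + 1))"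
    using q by (simp add: divide_simps) (simp add: power2_eq_square algebra_simps)
  then show ?thesis using 1 2 by (simp add: s_def C_def)
qed

section \<open>Neighbours and arcs of a regular graph\<close>

text \<open>With degree \<open>q + 1\<close> a path has \<open>q\<close> ways to go on without
  turning back. Connectedness enters as a hypothesis of \<open>balanced_edge_fun\<close>.\<close>

locale regular_simple_graph =
  fixes V :: "'a set" and E :: "'a set set" and q :: nat
  assumes finite_V: "finite V" and simple: "simple_graph V E"
    and degree: "\<And>v. v \<in> V \<Longrightarrow> vertex_degree E v = q + 1" and q_ge_2: "q \<ge> 2"
begin

definition nbrs :: "'a \<Rightarrow> 'a set" where
  "nbrs v = {w. {v, w} \<in> E}"

text \<open>Oriented edges: the last arc of a path determines how it can be continued.\<close>

definition arcs :: "('a \<times> 'a) set" where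
  "arcs = {(x, y). {x, y} \<in> E}"

lemma edgeD:
  assumes "{x, y} \<in> E"
  shows "x \<in> V" "y \<in> V" "x \<noteq> y"
proof -
  have "{x, y} \<subseteq> V" "card {x, y} = 2" using simple assms unfolding simple_graph_def by blast+
  then show "x \<in> V" "y \<in> V" "x \<noteq> y" by auto
qed

lemma edgeE:
  assumes "e \<in> E"
  obtains x y where "e = {x, y}" "x \<noteq> y" "x \<in> V" "y \<in> V"
proof -
  have "card e = 2" "e \<subseteq> V" using simple assms unfolding simple_graph_def by blast+
  then show ?thesis using that by (auto simp: card_2_iff)
qed

lemma nbrs_sym: "w \<in> nbrs v \<longleftrightarrow> v \<in> nbrs w"
  by (simp add: nbrs_def insert_commute)

lemma nbrs_subset: "nbrs v \<subseteq> V"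
  using edgeD unfolding nbrs_def by blast

lemma finite_nbrs [simp]: "finite (nbrs v)"
  using nbrs_subset finite_V finite_subset by blast

lemma card_nbrs: assumes "v \<in> V" shows "card (nbrs v) = q + 1"
proof -
  have "bij_betw (\<lambda>w. {v, w}) (nbrs v) {e \<in> E. v \<in> e}"
    unfolding bij_betw_def
  proof
    show "inj_on (\<lambda>w. {v, w}) (nbrs v)" by (auto simp: inj_on_def doubleton_eq_iff)
    show "(\<lambda>w. {v, w}) ` nbrs v = {e \<in> E. v \<in> e}"
    proof (intro equalityI subsetI)
      fix e assume e: "e \<in> {e \<in> E. v \<in> e}"
      then obtain x y where "e = {x, y}" using edgeE by blast
      with e have "e = {v, x} \<or> e = {v, y}" by auto
      with e show "e \<in> (\<lambda>w. {v, w}) ` nbrs v" by (auto simp: nbrs_def)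
    qed (auto simp: nbrs_def)
  qed
  from bij_betw_same_card[OF this] show ?thesis using degree[OF assms] by (simp add: vertex_degree_def)
qed

lemma arcs_eq: "arcs = Sigma V nbrs"
  using edgeD by (auto simp: arcs_def nbrs_def)

lemma finite_arcs [simp]: "finite arcs"
  using finite_V by (simp add: arcs_eq)

lemma sum_arcs: "(\<Sum>a\<in>arcs. G a) = (\<Sum>y\<in>V. \<Sum>z\<in>nbrs y. G (y, z))" for G :: "'a \<times> 'a \<Rightarrow> real"
  using finite_V by (simp add: arcs_eq sum.Sigma)

lemma sum_arcs_swap: "(\<Sum>a\<in>arcs. G (prod.swap a)) = (\<Sum>a\<in>arcs. G a)" for G :: "'a \<times> 'a \<Rightarrow> real"
  by (rule sum.reindex_bij_witness[where i = prod.swap and j = prod.swap])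
    (auto simp: arcs_def insert_commute)

text \<open>Arcs are grouped by head here and by tail in \<open>sum_arcs\<close>. Since
  \<open>nb_avg g (x, y)\<close> involves \<open>g\<close> on arcs leaving \<open>y\<close>, the two
  groupings together localise the comparison of norms at \<open>y\<close>.\<close>

lemma sum_arcs': "(\<Sum>a\<in>arcs. G a) = (\<Sum>y\<in>V. \<Sum>x\<in>nbrs y. G (x, y))" for G :: "'a \<times> 'a \<Rightarrow> real"
  using sum_arcs[of "\<lambda>a. G (prod.swap a)"] by (simp add: sum_arcs_swap)

section \<open>The non-backtracking operator and the functions whose norm it preserves\<close>

text \<open>The operator \<open>P\<close> of the overview: Hashimoto's edge operator divided by
  \<open>q\<close>, which makes it an average at every arc.\<close>

definition nb_avg :: "('a \<times> 'a \<Rightarrow> real) \<Rightarrow> 'a \<times> 'a \<Rightarrow> real" where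
  "nb_avg g = (\<lambda>(x, y). (\<Sum>z\<in>nbrs y - {x}. g (y, z)) / q)"

definition sq_norm :: "('a \<times> 'a \<Rightarrow> real) \<Rightarrow> real" where
  "sq_norm g = (\<Sum>a\<in>arcs. (g a)\<^sup>2)"

lemma sq_norm_nonneg: "0 \<le> sq_norm g"
  by (simp add: sq_norm_def sum_nonneg)

text \<open>The operator splits into one leave-one-out block per vertex \<open>y\<close>, taking
  values on arcs out of \<open>y\<close> to values on arcs into \<open>y\<close>. The loss of norm
  measures how far \<open>g\<close> is from depending on the tail alone.\<close>

lemma sq_norm_nb_avg:
  "sq_norm g - sq_norm (nb_avg g) = (1 - 1 / (real q)\<^sup>2) *
    (\<Sum>y\<in>V. \<Sum>z\<in>nbrs y. (g (y, z) - (\<Sum>w\<in>nbrs y. g (y, w)) / (q + 1))\<^sup>2)"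
proof -
  have "sq_norm g - sq_norm (nb_avg g) = (\<Sum>y\<in>V. (\<Sum>z\<in>nbrs y. (g (y, z))\<^sup>2) -
      (\<Sum>x\<in>nbrs y. ((\<Sum>z\<in>nbrs y - {x}. g (y, z)) / q)\<^sup>2))"
    unfolding sq_norm_def
    by (subst sum_arcs, subst sum_arcs') (simp add: nb_avg_def sum_subtractf)
  also have "\<dots> = (\<Sum>y\<in>V. (1 - 1 / (real q)\<^sup>2) *
      (\<Sum>z\<in>nbrs y. (g (y, z) - (\<Sum>w\<in>nbrs y. g (y, w)) / (q + 1))\<^sup>2))"
    using q_ge_2 by (intro sum.cong refl sum_leave_one_out_squares) (simp_all add: card_nbrs)
  finally show ?thesis by (simp add: sum_distrib_left)
qed

lemma gap_factor_pos: "0 < 1 - 1 / (real q)\<^sup>2"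
proof -
  have "1 < (real q)\<^sup>2" using q_ge_2 by (simp add: one_less_power)
  then show ?thesis by (simp add: divide_simps)
qed

lemma sq_norm_nb_avg_le: "sq_norm (nb_avg g) \<le> sq_norm g"
proof -
  have "0 \<le> sq_norm g - sq_norm (nb_avg g)"
    unfolding sq_norm_nb_avg using gap_factor_pos by (intro mult_nonneg_nonneg sum_nonneg) auto
  then show ?thesis by simp
qed

lemma sq_norm_nb_avg_eqD:
  assumes "sq_norm (nb_avg g) = sq_norm g" "y \<in> V" "z \<in> nbrs y"
  shows "g (y, z) = (\<Sum>w\<in>nbrs y. g (y, w)) / (q + 1)"
proof -
  have "(\<Sum>y\<in>V. \<Sum>z\<in>nbrs y. (g (y, z) - (\<Sum>w\<in>nbrs y. g (y, w)) / (q + 1))\<^sup>2) = 0"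
    using sq_norm_nb_avg[of g] gap_factor_pos assms(1) by auto
  then have 0: "(\<Sum>z\<in>nbrs y. (g (y, z) - (\<Sum>w\<in>nbrs y. g (y, w)) / (q + 1))\<^sup>2) = 0"
    using finite_V assms(2) by (subst (asm) sum_nonneg_eq_0_iff) (auto intro: sum_nonneg)
  have "(g (y, z) - (\<Sum>w\<in>nbrs y. g (y, w)) / (q + 1))\<^sup>2 = 0"
    by (rule sum_nonneg_0[OF finite_nbrs _ 0 assms(3)]) (rule zero_le_power2)
  then show ?thesis by (simp only: zero_eq_power2 right_minus_eq)
qed

text \<open>On a connected graph the condition below holds for the constants and, if the graph is
  bipartite, for the functions that are constant on each of the two sides.\<close>

definition nbr_const :: "('a \<Rightarrow> real) \<Rightarrow> bool" where
  "nbr_const h \<longleftrightarrow> (\<forall>y\<in>V. \<forall>z\<in>nbrs y. \<forall>z'\<in>nbrs y. h z = h z')"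

text \<open>Orthogonality to the functions that could keep their norm under two steps; that these
  have the form \<open>h (fst a)\<close> with \<open>nbr_const h\<close> is shown inside
  \<open>sq_norm_eq_0\<close>.\<close>

definition balanced :: "('a \<times> 'a \<Rightarrow> real) \<Rightarrow> bool" where
  "balanced g \<longleftrightarrow> (\<forall>h. nbr_const h \<longrightarrow> (\<Sum>a\<in>arcs. h (fst a) * g a) = 0)"

text \<open>The adjoint of the operator takes \<open>h\<close>, read at tails, to \<open>h'\<close>,
  where \<open>h' y\<close> is the common value of \<open>h\<close> on the neighbours of
  \<open>y\<close>; and \<open>h'\<close> is again \<open>nbr_const\<close>.\<close>

lemma balanced_nb_avg:
  assumes "balanced g"
  shows "balanced (nb_avg g)"
  unfolding balanced_def
proof (intro allI impI)
  fix h assume h: "nbr_const h"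
  define h' where "h' y = (\<Sum>z\<in>nbrs y. h z) / (q + 1)" for y
  have h': "h' y = h x" if "y \<in> V" "x \<in> nbrs y" for x y
  proof -
    have "(\<Sum>z\<in>nbrs y. h z) = (\<Sum>z\<in>nbrs y. h x)"
      using h that unfolding nbr_const_def by (intro sum.cong refl) blast
    then show ?thesis using that by (simp add: h'_def card_nbrs)
  qed
  have "nbr_const h'"
    unfolding nbr_const_def
  proof (intro ballI)
    fix w z z' assume "w \<in> V" "z \<in> nbrs w" "z' \<in> nbrs w"
    then have "z \<in> V" "w \<in> nbrs z" "z' \<in> V" "w \<in> nbrs z'" using nbrs_subset nbrs_sym by blast+
    \<comment> \<open>Both values equal \<open>h w\<close>.\<close>
    then show "h' z = h' z'" by (simp add: h'[of _ w])
  qed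
  with assms have 0: "(\<Sum>a\<in>arcs. h' (fst a) * g a) = 0" unfolding balanced_def by blast
  have "(\<Sum>a\<in>arcs. h (fst a) * nb_avg g a) =
      (\<Sum>y\<in>V. \<Sum>x\<in>nbrs y. h x * ((\<Sum>z\<in>nbrs y - {x}. g (y, z)) / q))"
    by (simp add: sum_arcs' nb_avg_def)
  also have "\<dots> = (\<Sum>y\<in>V. \<Sum>x\<in>nbrs y. \<Sum>z\<in>nbrs y - {x}. h' y * g (y, z) / q)"
    by (intro sum.cong refl) (simp add: h' sum_distrib_left sum_divide_distrib)
  \<comment> \<open>After the exchange of sums each \<open>z\<close> is counted for the
    \<open>q\<close> neighbours \<open>x\<close> other than \<open>z\<close>, which cancels the
    division by \<open>q\<close>.\<close>
  also have "\<dots> = (\<Sum>y\<in>V. \<Sum>z\<in>nbrs y. h' y * g (y, z))"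
  proof (rule sum.cong[OF refl])
    fix y assume "y \<in> V"
    then show "(\<Sum>x\<in>nbrs y. \<Sum>z\<in>nbrs y - {x}. h' y * g (y, z) / q) = (\<Sum>z\<in>nbrs y. h' y * g (y, z))"
      using q_ge_2 by (subst sum_Diff_singleton_swap) (simp_all add: card_nbrs)
  qed
  also have "\<dots> = 0" using 0 by (simp add: sum_arcs)
  finally show "(\<Sum>a\<in>arcs. h (fst a) * nb_avg g a) = 0" .
qed

lemma balanced_funpow: "balanced g \<Longrightarrow> balanced ((nb_avg ^^ n) g)"
  by (induction n) (simp_all add: balanced_nb_avg)

text \<open>Equality in the first step gives \<open>g (y, z) = a y\<close>, hence
  \<open>nb_avg g (x, y) = a y\<close>. Equality in the second step makes this depend on
  \<open>x\<close> alone, so \<open>a\<close> is \<open>nbr_const\<close> and \<open>g\<close> is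
  orthogonal to itself.\<close>

lemma sq_norm_eq_0:
  assumes "balanced g" "sq_norm (nb_avg (nb_avg g)) = sq_norm g"
  shows "sq_norm g = 0"
proof -
  define a where "a y = (\<Sum>w\<in>nbrs y. g (y, w)) / (q + 1)" for y
  have eq: "sq_norm (nb_avg (nb_avg g)) = sq_norm (nb_avg g)" "sq_norm (nb_avg g) = sq_norm g"
    using assms(2) sq_norm_nb_avg_le[of g] sq_norm_nb_avg_le[of "nb_avg g"] by auto
  have g: "g (y, z) = a y" if "y \<in> V" "z \<in> nbrs y" for y z
    unfolding a_def using sq_norm_nb_avg_eqD[OF eq(2) that] .
  have Pg: "nb_avg g (x, y) = a y" if "x \<in> V" "y \<in> nbrs x" for x y
  proof -
    have "y \<in> V" "x \<in> nbrs y" using that nbrs_subset nbrs_sym by blast+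
    then show ?thesis using q_ge_2 by (simp add: nb_avg_def g card_nbrs)
  qed
  have "nbr_const a"
    unfolding nbr_const_def
  proof (intro ballI)
    fix x y y' assume x: "x \<in> V" "y \<in> nbrs x" "y' \<in> nbrs x"
    have "nb_avg g (x, y) = nb_avg g (x, y')"
      using sq_norm_nb_avg_eqD[OF eq(1) x(1,2)] sq_norm_nb_avg_eqD[OF eq(1) x(1,3)] by (rule trans[OF _ sym])
    then show "a y = a y'" using Pg x by simp
  qed
  then have "(\<Sum>b\<in>arcs. a (fst b) * g b) = 0" using assms(1) unfolding balanced_def by blast
  moreover have "(\<Sum>b\<in>arcs. a (fst b) * g b) = sq_norm g"
    unfolding sq_norm_def by (intro sum.cong refl) (auto simp: arcs_eq g power2_eq_square)
  ultimately show ?thesis by simp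
qed

section \<open>Compactness and the spectral gap\<close>

lemma nb_avg_cong:
  assumes "\<And>a. a \<in> arcs \<Longrightarrow> g a = g' a" "a \<in> arcs"
  shows "nb_avg g a = nb_avg g' a"
proof -
  obtain x y where a: "a = (x, y)" by fastforce
  then have "y \<in> V" using assms(2) edgeD by (auto simp: arcs_def)
  then show ?thesis using assms(1) a by (auto simp: nb_avg_def arcs_eq intro!: sum.cong arg_cong2[where f = "(/)"])
qed

lemma nb_avg_scale: "nb_avg (\<lambda>a. c * g a) = (\<lambda>a. c * nb_avg g a)"
  by (auto simp: nb_avg_def sum_distrib_left fun_eq_iff)

lemma sq_norm_scale: "sq_norm (\<lambda>a. c * g a) = c\<^sup>2 * sq_norm g"
  by (simp add: sq_norm_def power_mult_distrib sum_distrib_left)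

lemma sq_norm_cong: "(\<And>a. a \<in> arcs \<Longrightarrow> g a = g' a) \<Longrightarrow> sq_norm g = sq_norm g'"
  by (simp add: sq_norm_def)

lemma continuous_on_sq_norm: "continuous_on A sq_norm"
  unfolding sq_norm_def
  by (intro continuous_intros continuous_on_subset[OF continuous_on_product_coordinates]) auto

lemma continuous_on_nb_avg: "continuous_on A nb_avg"
  unfolding nb_avg_def
  by (rule continuous_on_coordinatewise_then_product)
    (auto simp: case_prod_beta divide_inverse intro!: continuous_intros
      continuous_on_subset[OF continuous_on_product_coordinates])

text \<open>The type of vertices may be infinite, so functions are made to vanish off the finite set
  of arcs. The set is then closed in a product of compact sets, because a coordinate of a function
  of norm 1 lies in \<open>{-1..1}\<close>.\<close>

lemma compact_balanced_sphere:
  "compact {g. balanced g \<and> sq_norm g = 1 \<and> (\<forall>a. a \<notin> arcs \<longrightarrow> g a = 0)}" (is "compact ?K")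
proof -
  define B where "B = (\<lambda>a. if a \<in> arcs then {-1..1 :: real} else {0})"
  have "compactin (product_topology (\<lambda>_. euclidean) UNIV) (PiE UNIV B)"
    by (subst compactin_PiE) (auto simp: B_def)
  then have B: "compact (PiE UNIV B)" by (simp add: euclidean_product_topology)
  have coord: "continuous_on UNIV (\<lambda>g :: 'a \<times> 'a \<Rightarrow> real. g a)" for a
    by (rule continuous_on_product_coordinates)
  have "closed {g. balanced g}"
    unfolding balanced_def
    by (intro closed_Collect_all closed_Collect_imp open_Collect_const closed_Collect_eq
        continuous_intros coord)
  moreover have "closed {g. sq_norm g = 1}"
    by (intro closed_Collect_eq continuous_on_sq_norm continuous_intros)
  ultimately have "compact (PiE UNIV B \<inter> ({g. balanced g} \<inter> {g. sq_norm g = 1}))"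
    using B by (intro compact_Int_closed closed_Int)
  moreover have "?K = PiE UNIV B \<inter> ({g. balanced g} \<inter> {g. sq_norm g = 1})"
  proof -
    have "g a \<in> {-1..1}" if "sq_norm g = 1" "a \<in> arcs" for g a
    proof -
      have "(g a)\<^sup>2 \<le> 1" using that member_le_sum[of a arcs "\<lambda>a. (g a)\<^sup>2"] by (simp add: sq_norm_def)
      then show ?thesis by (simp add: power2_le_iff_abs_le[of 1 "g a", simplified] abs_le_iff)
    qed
    then show ?thesis by (auto simp: B_def PiE_def Pi_def split: if_splits)
  qed
  ultimately show ?thesis by simp
qed

text \<open>On the compact unit sphere the maximum is attained, and by \<open>sq_norm_eq_0\<close>
  it is below 1. Homogeneity extends the bound to all balanced functions.\<close>

lemma spectral_gap:
  "\<exists>\<kappa>. 0 \<le> \<kappa> \<and> \<kappa> < 1 \<and> (\<forall>g. balanced g \<longrightarrow> sq_norm (nb_avg (nb_avg g)) \<le> \<kappa> * sq_norm g)"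
proof -
  define K where "K = {g. balanced g \<and> sq_norm g = 1 \<and> (\<forall>a. a \<notin> arcs \<longrightarrow> g a = 0)}"
  have "\<exists>\<kappa>. 0 \<le> \<kappa> \<and> \<kappa> < 1 \<and> (\<forall>g\<in>K. sq_norm (nb_avg (nb_avg g)) \<le> \<kappa>)"
  proof (cases "K = {}")
    case True
    then show ?thesis by (intro exI[of _ 0]) simp
  next
    case False
    have "continuous_on K (\<lambda>g. sq_norm (nb_avg (nb_avg g)))"
      by (intro continuous_on_compose2[OF continuous_on_sq_norm[of UNIV]]
          continuous_on_compose2[OF continuous_on_nb_avg[of UNIV]] continuous_on_nb_avg) auto
    from continuous_attains_sup[OF compact_balanced_sphere[folded K_def] False this]
    obtain g where g: "g \<in> K"
      "\<And>g'. g' \<in> K \<Longrightarrow> sq_norm (nb_avg (nb_avg g')) \<le> sq_norm (nb_avg (nb_avg g))" by blast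
    have "sq_norm (nb_avg (nb_avg g)) \<le> sq_norm g"
      using sq_norm_nb_avg_le order_trans by blast
    moreover have "sq_norm (nb_avg (nb_avg g)) \<noteq> sq_norm g"
      using sq_norm_eq_0[of g] g(1) by (auto simp: K_def)
    ultimately have "sq_norm (nb_avg (nb_avg g)) < 1" using g(1) by (simp add: K_def)
    then show ?thesis using g(2) sq_norm_nonneg by blast
  qed
  then obtain \<kappa> where k: "0 \<le> \<kappa>" "\<kappa> < 1"
    "\<And>g. g \<in> K \<Longrightarrow> sq_norm (nb_avg (nb_avg g)) \<le> \<kappa>" by blast
  have "sq_norm (nb_avg (nb_avg g)) \<le> \<kappa> * sq_norm g" if g: "balanced g" for g
  proof (cases "sq_norm g = 0")
    case True
    then show ?thesis using sq_norm_nb_avg_le[of g] sq_norm_nb_avg_le[of "nb_avg g"] by simp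
  next
    case False
    then have pos: "sq_norm g > 0" using sq_norm_nonneg[of g] by simp
    define c where "c = 1 / sqrt (sq_norm g)"
    have c: "c\<^sup>2 = 1 / sq_norm g" using pos by (simp add: c_def power_divide)
    \<comment> \<open>Scaling gives norm 1, and cutting off outside the arcs gives membership in
      \<open>K\<close>; neither norm involved sees the values off the arcs.\<close>
    define g' where "g' a = (if a \<in> arcs then c * g a else 0)" for a
    have n: "sq_norm g' = 1"
      using pos sq_norm_scale[of c g] by (simp add: sq_norm_cong[of g' "\<lambda>a. c * g a"] g'_def c)
    have "balanced g'"
      unfolding balanced_def
    proof (intro allI impI)
      fix h assume "nbr_const h"
      then have "c * (\<Sum>a\<in>arcs. h (fst a) * g a) = 0" using g unfolding balanced_def by simp
      then show "(\<Sum>a\<in>arcs. h (fst a) * g' a) = 0"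
        by (simp add: g'_def sum_distrib_left mult.left_commute)
    qed
    with n have "g' \<in> K" by (simp add: K_def g'_def)
    then have "sq_norm (nb_avg (nb_avg g')) \<le> \<kappa>" by (rule k)
    moreover have "sq_norm (nb_avg (nb_avg g')) = sq_norm (nb_avg (nb_avg (\<lambda>a. c * g a)))"
      by (intro sq_norm_cong nb_avg_cong) (simp_all add: g'_def)
    ultimately have "c\<^sup>2 * sq_norm (nb_avg (nb_avg g)) \<le> \<kappa>"
      by (simp add: nb_avg_scale sq_norm_scale)
    then show ?thesis using pos by (simp add: c field_simps)
  qed
  with k show ?thesis by blast
qed

section \<open>Exponential decay of the iterates\<close>

lemma sq_norm_funpow_even:
  assumes "0 \<le> \<kappa>" "\<And>g. balanced g \<Longrightarrow> sq_norm (nb_avg (nb_avg g)) \<le> \<kappa> * sq_norm g" "balanced g"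
  shows "sq_norm ((nb_avg ^^ (2 * k)) g) \<le> \<kappa> ^ k * sq_norm g"
proof (induction k)
  case 0
  then show ?case by simp
next
  case (Suc k)
  have "sq_norm ((nb_avg ^^ (2 * Suc k)) g) \<le> \<kappa> * sq_norm ((nb_avg ^^ (2 * k)) g)"
    using assms(2)[OF balanced_funpow[OF assms(3), of "2 * k"]] by simp
  also have "\<dots> \<le> \<kappa> * (\<kappa> ^ k * sq_norm g)" using Suc assms(1) by (rule mult_left_mono)
  finally show ?case by simp
qed

lemma nb_avg_funpow_decay:
  obtains \<beta> where "real q powr (- 1 / 2) \<le> \<beta>" "\<beta> < 1"
    "\<And>g r. balanced g \<Longrightarrow> sqrt (sq_norm ((nb_avg ^^ r) g)) \<le> sqrt (sq_norm g) * \<beta> ^ r / \<beta>"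
proof -
  obtain \<kappa> where k: "0 \<le> \<kappa>" "\<kappa> < 1"
    "\<And>g. balanced g \<Longrightarrow> sq_norm (nb_avg (nb_avg g)) \<le> \<kappa> * sq_norm g"
    using spectral_gap by blast
  \<comment> \<open>The factor \<open>\<kappa>\<close> bounds the squared norm over two steps, so
    the rate per step is its fourth root. The maximum puts \<open>\<beta>\<close> into the required
    range and keeps it positive if \<open>\<kappa>\<close> is 0.\<close>
  define \<beta> where "\<beta> = max (real q powr (- 1 / 2)) (sqrt (sqrt \<kappa>))"
  have "real q powr (- 1 / 2) < real q powr 0" using q_ge_2 by (intro powr_less_mono) auto
  then have b1: "\<beta> < 1" using k q_ge_2 by (simp add: \<beta>_def)
  have b0: "0 < \<beta>" using q_ge_2 by (simp add: \<beta>_def less_max_iff_disj)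
  have "\<kappa> = (sqrt (sqrt \<kappa>)) ^ 4"
    using k(1) by (simp add: power4_eq_xxxx flip: mult.assoc) (simp add: mult.assoc)
  also have "\<dots> \<le> \<beta> ^ 4" using k(1) by (intro power_mono) (simp_all add: \<beta>_def)
  finally have b4: "\<kappa> \<le> \<beta> ^ 4" .
  show ?thesis
  proof (rule that[of \<beta>])
    fix g :: "'a \<times> 'a \<Rightarrow> real" and r :: nat assume g: "balanced g"
    define j where "j = r div 2"
    have "sq_norm ((nb_avg ^^ r) g) \<le> sq_norm ((nb_avg ^^ (2 * j)) g)"
    proof (cases "even r")
      case True
      then show ?thesis by (simp add: j_def)
    next
      case False
      then have "r = Suc (2 * j)" by (simp add: j_def)
      then show ?thesis using sq_norm_nb_avg_le by simp
    qed
    also have "\<dots> \<le> \<kappa> ^ j * sq_norm g" by (rule sq_norm_funpow_even[OF k(1,3) g])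
    also have "\<dots> \<le> (\<beta> ^ 4) ^ j * sq_norm g"
      using b4 k(1) by (intro mult_right_mono power_mono sq_norm_nonneg)
    also have "(\<beta> ^ 4) ^ j = (\<beta> ^ (2 * j))\<^sup>2" by (simp flip: power_mult add: mult.commute)
    finally have "sqrt (sq_norm ((nb_avg ^^ r) g)) \<le> sqrt ((\<beta> ^ (2 * j))\<^sup>2 * sq_norm g)"
      by (rule real_sqrt_le_mono)
    also have "\<dots> = \<beta> ^ (2 * j) * sqrt (sq_norm g)" using b0 by (simp add: real_sqrt_mult)
    \<comment> \<open>For odd \<open>r\<close> the last step was only known to be non-expansive;
      division by \<open>\<beta>\<close> pays for it.\<close>
    also have "\<beta> ^ (2 * j) \<le> \<beta> ^ r / \<beta>"
    proof -
      have "\<beta> ^ Suc (2 * j) \<le> \<beta> ^ r" using b0 b1 by (intro power_decreasing) (auto simp: j_def)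
      then show ?thesis using b0 by (simp add: field_simps)
    qed
    finally show "sqrt (sq_norm ((nb_avg ^^ r) g)) \<le> sqrt (sq_norm g) * \<beta> ^ r / \<beta>"
      by (simp add: mult_right_mono sq_norm_nonneg mult.commute)
  qed (use b1 in \<open>auto simp: \<beta>_def\<close>)
qed

section \<open>Spherical means as iterates of the operator\<close>

definition edge_fun :: "('a set \<Rightarrow> real) \<Rightarrow> 'a \<times> 'a \<Rightarrow> real" where
  "edge_fun F = (\<lambda>(x, y). F {x, y})"

text \<open>The \<open>r + 2\<close> vertices are those of the arc \<open>(x, y)\<close> and of
  \<open>r\<close> further steps, one for each application of \<open>nb_avg\<close>.\<close>

definition paths_via :: "nat \<Rightarrow> 'a \<Rightarrow> 'a \<Rightarrow> 'a list set" where
  "paths_via r x y = {p \<in> cover_verts V E x. length p = r + 2 \<and> hd (tl p) = y}"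

lemma finite_paths: "finite {p \<in> cover_verts V E x. length p = n}"
proof (rule finite_subset)
  show "finite {p. set p \<subseteq> V \<and> length p = n}" using finite_V by (rule finite_lists_length_eq)
  show "{p \<in> cover_verts V E x. length p = n} \<subseteq> {p. set p \<subseteq> V \<and> length p = n}"
    by (auto simp: cover_verts_def walk_def)
qed

lemma finite_paths_via: "finite (paths_via r x y)"
  by (rule finite_subset[OF _ finite_paths[of x "r + 2"]]) (auto simp: paths_via_def)

lemma paths_via_0: "y \<in> nbrs x \<Longrightarrow> paths_via 0 x y = {[x, y]}"
proof (intro equalityI subsetI)
  fix p assume "p \<in> paths_via 0 x y"
  then have p: "p \<in> cover_verts V E x" "length p = 2" "hd (tl p) = y" by (auto simp: paths_via_def)
  from p(1) obtain t where "p = x # t" by (rule cover_verts_ConsD)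
  with p(2,3) show "p \<in> {[x, y]}" by (cases t) auto
qed (use edgeD in \<open>auto simp: paths_via_def cover_verts_Cons2 nbrs_def\<close>)

text \<open>Without its first vertex the path starts at \<open>y\<close>; the condition
  \<open>z \<noteq> x\<close> is non-backtracking at the vertex removed.\<close>

lemma paths_via_Suc:
  assumes "y \<in> nbrs x"
  shows "paths_via (Suc r) x y = (\<Union>z\<in>nbrs y - {x}. (#) x ` paths_via r y z)"
proof (intro equalityI subsetI)
  fix p assume "p \<in> paths_via (Suc r) x y"
  then have p: "p \<in> cover_verts V E x" "length p = r + 3" "hd (tl p) = y" by (auto simp: paths_via_def)
  from p(1) obtain t where "p = x # t" by (rule cover_verts_ConsD)
  with p(2,3) obtain z s where s: "p = x # y # z # s" by (cases t; cases "tl t") auto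
  have "y # z # s \<in> cover_verts V E y" "z \<noteq> x" "{y, z} \<in> E"
    using p(1) unfolding s cover_verts_Cons2 by auto
  with s p(2) show "p \<in> (\<Union>z\<in>nbrs y - {x}. (#) x ` paths_via r y z)"
    by (auto simp: paths_via_def nbrs_def intro!: bexI[of _ z])
next
  fix p assume "p \<in> (\<Union>z\<in>nbrs y - {x}. (#) x ` paths_via r y z)"
  then obtain z u where z: "z \<noteq> x" "p = x # u" "u \<in> cover_verts V E y" "length u = r + 2" "hd (tl u) = z"
    by (auto simp: paths_via_def)
  from z(3) obtain t where "u = y # t" by (rule cover_verts_ConsD)
  with z(4,5) obtain s where s: "u = y # z # s" by (cases t) auto
  have "{x, y} \<in> E" using assms by (simp add: nbrs_def)
  with z edgeD[OF this] show "p \<in> paths_via (Suc r) x y"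
    unfolding s by (simp add: paths_via_def cover_verts_Cons2[of x y])
qed

lemma last_edge_Cons: "length p \<ge> 2 \<Longrightarrow> last_edge (x # p) = last_edge p"
  by (cases p; cases "tl p") (auto simp: last_edge_def)

text \<open>Peeling off the first step turns the sum over paths into a sum over continuations of the
  arc. The factor \<open>q ^ r\<close> undoes \<open>r\<close> normalisations.\<close>

lemma sum_paths_via:
  assumes "y \<in> nbrs x"
  shows "(\<Sum>p\<in>paths_via r x y. F (last_edge p)) = q ^ r * (nb_avg ^^ r) (edge_fun F) (x, y)"
  using assms
proof (induction r arbitrary: x y)
  case 0
  then show ?case by (simp add: paths_via_0 last_edge_def edge_fun_def)
next
  case (Suc r)
  have "(\<Sum>p\<in>paths_via (Suc r) x y. F (last_edge p)) =
      (\<Sum>z\<in>nbrs y - {x}. \<Sum>p\<in>(#) x ` paths_via r y z. F (last_edge p))"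
    unfolding paths_via_Suc[OF Suc.prems]
    by (intro sum.UNION_disjoint ballI impI finite_imageI finite_paths_via finite_Diff finite_nbrs)
      (auto simp: paths_via_def)
  also have "\<dots> = (\<Sum>z\<in>nbrs y - {x}. \<Sum>p\<in>paths_via r y z. F (last_edge p))"
  proof (rule sum.cong[OF refl])
    fix z
    have "(\<Sum>p\<in>(#) x ` paths_via r y z. F (last_edge p)) = (\<Sum>p\<in>paths_via r y z. F (last_edge (x # p)))"
      by (subst sum.reindex) simp_all
    also have "\<dots> = (\<Sum>p\<in>paths_via r y z. F (last_edge p))"
      by (intro sum.cong refl) (simp add: last_edge_Cons paths_via_def)
    finally show "(\<Sum>p\<in>(#) x ` paths_via r y z. F (last_edge p)) = (\<Sum>p\<in>paths_via r y z. F (last_edge p))" .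
  qed
  also have "\<dots> = (\<Sum>z\<in>nbrs y - {x}. q ^ r * (nb_avg ^^ r) (edge_fun F) (y, z))"
    by (rule sum.cong[OF refl]) (simp add: Suc.IH)
  also have "\<dots> = q ^ Suc r * (nb_avg ^^ Suc r) (edge_fun F) (x, y)"
    using q_ge_2 by (simp add: nb_avg_def[of "(nb_avg ^^ r) _"] flip: sum_distrib_left)
  finally show ?case .
qed

lemma sum_paths:
  "(\<Sum>p | p \<in> cover_verts V E x \<and> length p = r + 2. F (last_edge p)) =
    q ^ r * (\<Sum>y\<in>nbrs x. (nb_avg ^^ r) (edge_fun F) (x, y))"
proof -
  have "{p \<in> cover_verts V E x. length p = r + 2} = (\<Union>y\<in>nbrs x. paths_via r x y)"
  proof (intro equalityI subsetI)
    fix p assume p: "p \<in> {p \<in> cover_verts V E x. length p = r + 2}"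
    then obtain t where "p = x # t" by (auto elim: cover_verts_ConsD)
    with p obtain y s where s: "p = x # y # s" by (cases t) auto
    from p have "{x, y} \<in> E" unfolding s by (simp add: cover_verts_Cons2)
    with p s show "p \<in> (\<Union>y\<in>nbrs x. paths_via r x y)"
      by (auto simp: paths_via_def nbrs_def)
  qed (auto simp: paths_via_def)
  then have "(\<Sum>p | p \<in> cover_verts V E x \<and> length p = r + 2. F (last_edge p)) =
      (\<Sum>p\<in>(\<Union>y\<in>nbrs x. paths_via r x y). F (last_edge p))" by simp
  also have "\<dots> = (\<Sum>y\<in>nbrs x. \<Sum>p\<in>paths_via r x y. F (last_edge p))"
    by (intro sum.UNION_disjoint ballI impI finite_imageI finite_paths_via finite_Diff finite_nbrs)
      (auto simp: paths_via_def)
  also have "\<dots> = (\<Sum>y\<in>nbrs x. q ^ r * (nb_avg ^^ r) (edge_fun F) (x, y))"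
    by (rule sum.cong[OF refl]) (rule sum_paths_via)
  finally show ?thesis by (simp add: sum_distrib_left)
qed

lemma nb_avg_funpow_const: "a \<in> arcs \<Longrightarrow> (nb_avg ^^ r) (\<lambda>_. c) a = c"
proof (induction r arbitrary: a)
  case 0
  then show ?case by simp
next
  case (Suc r)
  have "nb_avg ((nb_avg ^^ r) (\<lambda>_. c)) a = nb_avg (\<lambda>_. c) a"
    using Suc by (intro nb_avg_cong)
  also have "\<dots> = c"
  proof -
    obtain x y where a: "a = (x, y)" by fastforce
    then have "{x, y} \<in> E" using Suc.prems by (simp add: arcs_def)
    then have "y \<in> V" "x \<in> nbrs y" using edgeD by (auto simp: nbrs_def insert_commute)
    then show ?thesis using q_ge_2 by (simp add: a nb_avg_def card_nbrs)
  qed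
  finally show ?case by simp
qed

text \<open>The count is the path sum of the constant 1, which the operator fixes on arcs.\<close>

lemma card_paths:
  assumes "x \<in> V"
  shows "real (card {p \<in> cover_verts V E x. length p = r + 2}) = real q ^ r * real (q + 1)"
proof -
  have "real (card {p \<in> cover_verts V E x. length p = r + 2}) =
      q ^ r * (\<Sum>y\<in>nbrs x. (nb_avg ^^ r) (edge_fun (\<lambda>_. 1)) (x, y))"
    using sum_paths[where F = "\<lambda>_. 1"] by simp
  also have "edge_fun (\<lambda>_. 1) = (\<lambda>_. 1)" by (auto simp: edge_fun_def)
  also have "(\<Sum>y\<in>nbrs x. (nb_avg ^^ r) (\<lambda>_. 1) (x, y)) = q + 1"
    using assms by (simp add: nb_avg_funpow_const arcs_eq card_nbrs)
  finally show ?thesis by simp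
qed

lemma spherical_mean_eq:
  assumes "x \<in> V"
  shows "spherical_mean V E x r [x] F = (\<Sum>y\<in>nbrs x. (nb_avg ^^ r) (edge_fun F) (x, y)) / (q + 1)"
  unfolding spherical_mean_root card_paths[OF assms] sum_paths using q_ge_2
  by (simp del: of_nat_add)

text \<open>The mean averages values at the \<open>q + 1\<close> arcs leaving \<open>x\<close>, each
  bounded by the norm over all arcs. The bound does not mention \<open>x\<close>, which makes the
  final constant independent of the basepoint.\<close>

lemma abs_spherical_mean_le:
  assumes "x \<in> V"
  shows "\<bar>spherical_mean V E x r [x] F\<bar> \<le> sqrt (sq_norm ((nb_avg ^^ r) (edge_fun F)))"
proof -
  let ?g = "(nb_avg ^^ r) (edge_fun F)"
  have "\<bar>?g (x, y)\<bar> \<le> sqrt (sq_norm ?g)" if "y \<in> nbrs x" for y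
  proof (rule real_le_rsqrt)
    have "(x, y) \<in> arcs" using that assms by (simp add: arcs_eq)
    then show "\<bar>?g (x, y)\<bar>\<^sup>2 \<le> sq_norm ?g"
      unfolding sq_norm_def using member_le_sum[of "(x, y)" arcs "\<lambda>a. (?g a)\<^sup>2"] by simp
  qed
  then have "(\<Sum>y\<in>nbrs x. \<bar>?g (x, y)\<bar>) \<le> (\<Sum>y\<in>nbrs x. sqrt (sq_norm ?g))" by (rule sum_mono)
  then have "\<bar>\<Sum>y\<in>nbrs x. ?g (x, y)\<bar> \<le> (q + 1) * sqrt (sq_norm ?g)"
    using assms by (intro order_trans[OF sum_abs]) (simp add: card_nbrs)
  then show ?thesis
    by (simp add: spherical_mean_eq[OF assms] abs_divide divide_le_eq mult.commute)
qed

section \<open>Functions on edges as symmetric functions on arcs\<close>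

text \<open>Every edge carries two arcs, distinct because there are no loops.\<close>

lemma sum_arcs_edges: "(\<Sum>a\<in>arcs. edge_fun F a) = 2 * (\<Sum>e\<in>E. F e)"
proof -
  have finE: "finite E"
    using simple finite_V unfolding simple_graph_def by (intro finite_subset[of E "Pow V"]) auto
  have "(\<Sum>e\<in>E. \<Sum>a | a \<in> arcs \<and> {fst a, snd a} = e. edge_fun F a) = (\<Sum>a\<in>arcs. edge_fun F a)"
    by (rule sum.group[OF finite_arcs finE]) (auto simp: arcs_def)
  moreover have "(\<Sum>a | a \<in> arcs \<and> {fst a, snd a} = e. edge_fun F a) = 2 * F e" if e: "e \<in> E" for e
  proof -
    obtain x y where xy: "e = {x, y}" "x \<noteq> y" using e by (rule edgeE)
    have "{a \<in> arcs. {fst a, snd a} = e} = {(x, y), (y, x)}"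
      using e xy by (auto simp: arcs_def doubleton_eq_iff insert_commute)
    then show ?thesis using xy by (simp add: edge_fun_def insert_commute)
  qed
  ultimately show ?thesis by (simp add: sum_distrib_left)
qed

lemma sq_norm_edge_fun: "sq_norm (edge_fun F) = 2 * (\<Sum>e\<in>E. (F e)\<^sup>2)"
proof -
  have "sq_norm (edge_fun F) = (\<Sum>a\<in>arcs. edge_fun (\<lambda>e. (F e)\<^sup>2) a)"
    unfolding sq_norm_def by (intro sum.cong refl) (simp add: edge_fun_def case_prod_beta)
  then show ?thesis by (simp add: sum_arcs_edges)
qed

text \<open>The value of \<open>h\<close> at a neighbour of a vertex does not depend on the
  neighbour. Hence a step of the walk only exchanges the two summands.\<close>

lemma nbr_const_walk:
  assumes "nbr_const h" "walk V E p" "w \<in> nbrs (hd p)" "w' \<in> nbrs (last p)"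
  shows "h (hd p) + h w = h (last p) + h w'"
  using assms(2-4)
proof (induction p arbitrary: w)
  case Nil
  then show ?case by (simp add: walk_def)
next
  case (Cons x p)
  have x: "x \<in> V" using Cons.prems(1) by (simp add: walk_Cons)
  show ?case
  proof (cases "p = []")
    case True
    then have "w \<in> nbrs x" "w' \<in> nbrs x" using Cons.prems by simp_all
    then have "h w = h w'" using assms(1) x unfolding nbr_const_def by blast
    then show ?thesis using True by simp
  next
    case False
    then have w: "walk V E p" "{x, hd p} \<in> E" using Cons.prems(1) by (simp_all add: walk_Cons)
    then have *: "x \<in> nbrs (hd p)" "hd p \<in> nbrs x" by (simp_all add: nbrs_def insert_commute)
    have "h (hd p) + h x = h (last p) + h w'"
      using Cons.IH[OF w(1) *(1)] Cons.prems(3) False by simp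
    moreover have "w \<in> nbrs x" using Cons.prems(2) by simp
    then have "h w = h (hd p)" using assms(1) *(2) x unfolding nbr_const_def by blast
    ultimately show ?thesis using False by simp
  qed
qed

text \<open>The function \<open>edge_fun F\<close> is invariant under reversal of arcs, so pairing it with
  \<open>h x\<close> is the same as pairing it with \<open>(h x + h y) / 2\<close>, which is constant on a connected graph.\<close>

lemma balanced_edge_fun:
  assumes conn: "connected_graph V E" and F: "(\<Sum>e\<in>E. F e) = 0"
  shows "balanced (edge_fun F)"
  unfolding balanced_def
proof (intro allI impI)
  fix h assume h: "nbr_const h"
  have "\<exists>c. \<forall>a\<in>arcs. h (fst a) + h (snd a) = c"
  proof (cases "arcs = {}")
    case False
    then obtain u u' where u: "(u, u') \<in> arcs" by fastforce
    have "h x + h y = h u + h u'" if a: "(x, y) \<in> arcs" for x y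
    proof -
      have "x \<in> V" "u \<in> V" "y \<in> nbrs x" "u' \<in> nbrs u" using a u by (auto simp: arcs_eq)
      moreover obtain p where "walk V E p" "hd p = x" "last p = u"
        using conn \<open>x \<in> V\<close> \<open>u \<in> V\<close> unfolding connected_graph_def by blast
      ultimately show ?thesis using nbr_const_walk[OF h] by blast
    qed
    then show ?thesis by (intro exI[of _ "h u + h u'"]) auto
  qed simp
  then obtain c where c: "\<And>a. a \<in> arcs \<Longrightarrow> h (fst a) + h (snd a) = c" by blast
  have "(\<Sum>a\<in>arcs. h (fst a) * edge_fun F a) = (\<Sum>a\<in>arcs. h (snd a) * edge_fun F a)"
    by (subst sum_arcs_swap[symmetric])
      (simp add: edge_fun_def case_prod_beta insert_commute)
  then have "2 * (\<Sum>a\<in>arcs. h (fst a) * edge_fun F a) =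
      (\<Sum>a\<in>arcs. h (fst a) * edge_fun F a) + (\<Sum>a\<in>arcs. h (snd a) * edge_fun F a)" by simp
  also have "\<dots> = (\<Sum>a\<in>arcs. (h (fst a) + h (snd a)) * edge_fun F a)"
    by (simp add: distrib_right sum.distrib)
  also have "\<dots> = c * (\<Sum>a\<in>arcs. edge_fun F a)" by (simp add: c sum_distrib_left)
  also have "\<dots> = 0" by (simp add: sum_arcs_edges F)
  finally show "(\<Sum>a\<in>arcs. h (fst a) * edge_fun F a) = 0" by simp
qed

lemma edge_fun_funpow_diff_const:
  assumes "a \<in> arcs"
  shows "(nb_avg ^^ r) (edge_fun (\<lambda>e. F e - m)) a = (nb_avg ^^ r) (edge_fun F) a - m"
  using assms
proof (induction r arbitrary: a)
  case 0
  then show ?case by (simp add: edge_fun_def case_prod_beta)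
next
  case (Suc r)
  obtain x y where a: "a = (x, y)" by fastforce
  then have y: "y \<in> V" "x \<in> nbrs y"
    using Suc.prems edgeD by (auto simp: arcs_def nbrs_def insert_commute)
  have "(\<Sum>z\<in>nbrs y - {x}. (nb_avg ^^ r) (edge_fun (\<lambda>e. F e - m)) (y, z)) =
      (\<Sum>z\<in>nbrs y - {x}. (nb_avg ^^ r) (edge_fun F) (y, z)) - q * m"
    using y by (simp add: Suc.IH arcs_eq sum_subtractf card_nbrs)
  then show ?case using q_ge_2 by (simp add: a nb_avg_def[of "(nb_avg ^^ r) _"] diff_divide_distrib)
qed

lemma spherical_mean_diff_const:
  assumes "x \<in> V"
  shows "spherical_mean V E x r [x] (\<lambda>e. F e - m) = spherical_mean V E x r [x] F - m"
  using assms
  by (simp add: spherical_mean_eq edge_fun_funpow_diff_const arcs_eq sum_subtractf card_nbrs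
      diff_divide_distrib)

end

section \<open>Centring, degrees and the final estimate\<close>

lemma sum_squares_diff_mean_le:
  fixes f :: "'b \<Rightarrow> real"
  shows "(\<Sum>e\<in>E. (f e - sum f E / card E)\<^sup>2) \<le> (\<Sum>e\<in>E. (f e)\<^sup>2)"
proof -
  define m where "m = sum f E / card E"
  have s: "card E * m = sum f E"
    \<comment> \<open>If \<open>E\<close> is empty or infinite, then \<open>card E\<close>,
      \<open>sum f E\<close> and \<open>m\<close> are all 0 by convention.\<close>
    by (cases "card E = 0") (auto simp: m_def card_eq_0_iff)
  have "(\<Sum>e\<in>E. (f e - m)\<^sup>2) = (\<Sum>e\<in>E. (f e)\<^sup>2 - 2 * m * f e + m\<^sup>2)"
    by (intro sum.cong refl) (simp add: power2_diff)
  also have "\<dots> = (\<Sum>e\<in>E. (f e)\<^sup>2) - 2 * m * sum f E + card E * m\<^sup>2"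
    unfolding sum.distrib sum_subtractf sum_distrib_left[symmetric] by simp
  also have "\<dots> = (\<Sum>e\<in>E. (f e)\<^sup>2) - card E * m\<^sup>2"
    by (simp add: power2_eq_square flip: s)
  also have "\<dots> \<le> (\<Sum>e\<in>E. (f e)\<^sup>2)" by simp
  finally show ?thesis by (simp add: m_def)
qed

text \<open>The edge \<open>{x, y}\<close> is the only one containing both \<open>x\<close> and
  \<open>y\<close>. It is counted in both vertex degrees but not in the edge degree, whence the
  2.\<close>

lemma edge_degree_eq:
  assumes "finite V" and sg: "simple_graph V E" and e: "{x, y} \<in> E"
  shows "edge_degree E {x, y} + 2 = vertex_degree E x + vertex_degree E y"
proof -
  have finE: "finite E"
    using sg assms(1) unfolding simple_graph_def by (intro finite_subset[of E "Pow V"]) auto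
  have c2: "card e = 2" if "e \<in> E" for e using sg that unfolding simple_graph_def by blast
  have both: "e' = {x, y}" if "e' \<in> E" "x \<in> e'" "y \<in> e'" for e'
    using c2[OF that(1)] c2[OF e] that(2,3)
    by (intro card_subset_eq[symmetric]) (auto intro: card_ge_0_finite)
  define A where "A v = {e' \<in> E. v \<in> e'}" for v
  have fin: "finite (A v)" for v using finE by (simp add: A_def)
  have "{e' \<in> E. e' \<noteq> {x, y} \<and> e' \<inter> {x, y} \<noteq> {}} = (A x - {{x, y}}) \<union> (A y - {{x, y}})"
    by (auto simp: A_def)
  then have "edge_degree E {x, y} = card ((A x - {{x, y}}) \<union> (A y - {{x, y}}))"
    by (simp add: edge_degree_def)
  also have "\<dots> = card (A x - {{x, y}}) + card (A y - {{x, y}})"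
  proof (rule card_Un_disjoint)
    show "(A x - {{x, y}}) \<inter> (A y - {{x, y}}) = {}" using both unfolding A_def by blast
  qed (simp_all add: fin)
  finally have "edge_degree E {x, y} = card (A x - {{x, y}}) + card (A y - {{x, y}})" .
  moreover have "card (A v) = Suc (card (A v - {{x, y}}))" if "v \<in> {x, y}" for v
    using e that by (intro card.remove fin) (simp add: A_def)
  ultimately show ?thesis by (simp add: vertex_degree_def A_def)
qed

text \<open>An edge between vertices of degree \<open>k\<close> gives
  \<open>2 * q + 2 = 2 * k\<close>.\<close>

lemma regular_simple_graphI:
  assumes "finite V" "simple_graph V E" "regular_graph V E"
    and "\<forall>e\<in>E. edge_degree E e = 2 * q" "2 * q \<ge> 4" "E \<noteq> {}"
  shows "regular_simple_graph V E q"
proof -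
  obtain k where k: "\<And>v. v \<in> V \<Longrightarrow> vertex_degree E v = k"
    using assms(3) unfolding regular_graph_def by blast
  obtain e where e: "e \<in> E" using assms(6) by blast
  then have "card e = 2" "e \<subseteq> V" using assms(2) unfolding simple_graph_def by blast+
  then obtain x y where "e = {x, y}" "x \<in> V" "y \<in> V" by (auto simp: card_2_iff)
  then have "k = q + 1" using edge_degree_eq[OF assms(1,2), of x y] k assms(4) e by simp
  then show ?thesis using assms k by unfold_locales auto
qed

lemma spherical_mean_no_edges:
  "spherical_mean V {} v r v0 f = 0"
proof -
  have "p @ [a] \<notin> cover_verts V {} v" if "p \<noteq> []" for p a
    using that by (simp add: cover_verts_def walk_snoc)
  then have "edge_sphere V {} v r v0 = {}"
    unfolding edge_sphere_def cover_edges_def by (auto simp: cover_verts_def walk_def)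
  then show ?thesis by (simp add: spherical_mean_def)
qed

theorem theorem2:
  fixes V :: "'a set" and E :: "'a set set" and q :: nat
  assumes "finite V"
    and "simple_graph V E"
    and "connected_graph V E"
    and "regular_graph V E"
    and "\<forall>e\<in>E. edge_degree E e = 2 * q"
    and "2 * q \<ge> 4"
  shows "\<exists>C \<beta> :: real. C > 0 \<and> \<beta> \<in> {real q powr (- 1 / 2)..<1} \<and>
    (\<forall>v_root\<in>V. \<forall>f :: 'a set \<Rightarrow> real. \<forall>v0 \<in> cover_verts V E v_root. \<forall>r :: nat.
       \<bar>spherical_mean V E v_root r v0 f - (1 / real (card E)) * (\<Sum>e\<in>E. f e)\<bar>
         \<le> C * edge_norm E f * \<beta> ^ r)"
proof (cases "E = {}")
  case True
  \<comment> \<open>Without edges both means are 0, since division by 0 yields 0, and so is the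
    norm; the least admissible \<open>\<beta>\<close> is taken.\<close>
  have "real q powr (- 1 / 2) < real q powr 0" using assms(6) by (intro powr_less_mono) auto
  then show ?thesis using assms(6)
    by (intro exI[of _ 1] exI[of _ "real q powr (- 1 / 2)"])
      (simp add: True spherical_mean_no_edges edge_norm_def)
next
  case False
  interpret regular_simple_graph V E q
    using regular_simple_graphI[OF assms(1,2,4,5,6) False] .
  obtain \<beta> where b: "real q powr (- 1 / 2) \<le> \<beta>" "\<beta> < 1"
    and decay: "\<And>g r. balanced g \<Longrightarrow> sqrt (sq_norm ((nb_avg ^^ r) g)) \<le> sqrt (sq_norm g) * \<beta> ^ r / \<beta>"
    by (rule nb_avg_funpow_decay) blast
  have "0 < real q powr (- 1 / 2)" using q_ge_2 by simp
  with b(1) have b0: "0 < \<beta>" by linarith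
  have "finite E"
    using assms(1,2) unfolding simple_graph_def by (intro finite_subset[of E "Pow V"]) auto
  with False have cE: "real (card E) > 0" by (simp add: card_gt_0_iff)
  \<comment> \<open>The factor \<open>sqrt 2\<close> comes from the two arcs of each edge, and
    \<open>1 / \<beta>\<close> from the decay at odd \<open>r\<close>.\<close>
  have "\<bar>spherical_mean V E v r v0 f - 1 / real (card E) * sum f E\<bar>
      \<le> sqrt 2 / \<beta> * edge_norm E f * \<beta> ^ r" if "v0 \<in> cover_verts V E v" for v v0 r f
  proof -
    define m where "m = sum f E / card E"
    define F where "F e = f e - m" for e
    define x where "x = last v0"
    have x: "spherical_mean V E v r v0 f = spherical_mean V E x r [x] f" "x \<in> V"
      using spherical_mean_trivial_path[OF assms(2) that, of r f] by (simp_all add: x_def)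
    \<comment> \<open>Centring \<open>f\<close> makes the decay estimate applicable and does not
      increase the norm.\<close>
    have "sum F E = 0" using cE by (simp add: F_def sum_subtractf m_def)
    then have bal: "balanced (edge_fun F)" by (rule balanced_edge_fun[OF assms(3)])
    have "\<bar>spherical_mean V E v r v0 f - m\<bar> = \<bar>spherical_mean V E x r [x] F\<bar>"
      using spherical_mean_diff_const[OF x(2), of r f m] by (simp add: x(1) F_def[abs_def])
    also have "\<dots> \<le> sqrt (sq_norm ((nb_avg ^^ r) (edge_fun F)))"
      by (rule abs_spherical_mean_le[OF x(2)])
    also have "\<dots> \<le> sqrt (sq_norm (edge_fun F)) * (\<beta> ^ r / \<beta>)"
      using decay[OF bal, of r] by simp
    also have "\<dots> \<le> sqrt (2 * (\<Sum>e\<in>E. (f e)\<^sup>2)) * (\<beta> ^ r / \<beta>)"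
      using b0 sum_squares_diff_mean_le[of f E, folded m_def]
      by (intro mult_right_mono) (simp_all add: sq_norm_edge_fun F_def)
    also have "\<dots> = sqrt 2 / \<beta> * edge_norm E f * \<beta> ^ r"
      by (simp add: edge_norm_def real_sqrt_mult)
    finally show ?thesis by (simp add: m_def)
  qed
  then show ?thesis
    using b b0 by (intro exI[of _ "sqrt 2 / \<beta>"] exI[of _ \<beta>]) auto
qed

end
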